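(* Let $M(\mathcal A)$ be the total space of a torus bundle $p\colon M(\mathcal A)\to S^1$ with monodromy $\mathcal A\in\mathrm{SL}(2,\mathbb Z)$, let $P$ be a spine of $M(\mathcal A)$, and let $F_t=p^{-1}(t)$ be any fiber. Then $K_t=P\cap F_t$ intersects every loop in $F_t$ representing a nonzero element of $\pi_1(F_t)\cong\mathbb Z^2$.
   Context: $M(\mathcal A)=T^2\times[0,1]/\big((x,1)\sim(\varphi(x),0)\big)$ with $\varphi$ a linear automorphism of $T^2$ inducing $\mathcal A$; $p$ is the projection to the circle. A polyhedron $P$ in the closed 3-manifold $M(\mathcal A)$ is a spine if $M(\mathcal A)\setminus P$ is an open 3-cell. *)

theory Defs
  imports "HOL-Analysis.Analysis"
begin

text \<open>Torus bundle M(A) over the circle with monodromy A in SL(2,Z), realised as the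
quotient of R^2 x R by the group generated by integer translations in the R^2 factor
and the map (x,s) to (A x, s - 1), so that (x,1) is identified with (A x, 0).\<close>

definition int_lattice :: "(real^2) set" where
  "int_lattice = {v. \<forall>i. v $ i \<in> \<int>}"

definition real_mat :: "int^2^2 \<Rightarrow> real^2^2" where
  "real_mat A = (\<chi> i j. real_of_int (A $ i $ j))"

definition tb_rel :: "int^2^2 \<Rightarrow> (((real^2) \<times> real) \<times> ((real^2) \<times> real)) set" where
  "tb_rel A = {((x, s), (y, r)). \<exists>n::nat. \<exists>v\<in>int_lattice.
       (y = (((*v) (real_mat A)) ^^ n) x + v \<and> r = s - real n)
     \<or> (x = (((*v) (real_mat A)) ^^ n) y + v \<and> s = r - real n)}"

text \<open>Underlying point set of M(A): equivalence classes.\<close>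
definition tb_space :: "int^2^2 \<Rightarrow> ((real^2) \<times> real) set set" where
  "tb_space A = UNIV // tb_rel A"

text \<open>Quotient topology on M(A).\<close>
definition tb_top :: "int^2^2 \<Rightarrow> ((real^2) \<times> real) set topology" where
  "tb_top A = topology (\<lambda>U. U \<subseteq> tb_space A \<and> open (\<Union>U))"

text \<open>Bundle projection p : M(A) -> S^1 = R/Z, the circle coordinate taken in [0,1).\<close>
definition tb_proj :: "((real^2) \<times> real) set \<Rightarrow> real" where
  "tb_proj c = frac (snd (SOME z. z \<in> c))"

text \<open>Fibre F_t = p^{-1}(t), t in R read modulo 1.\<close>
definition tb_fiber :: "int^2^2 \<Rightarrow> real \<Rightarrow> ((real^2) \<times> real) set set" where
  "tb_fiber A t = {c \<in> tb_space A. tb_proj c = frac t}"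

text \<open>Polyhedron in M(A) (PL structure induced from the affine covering R^3 -> M(A)):
its preimage in R^2 x R is a locally finite union of convex polytopes.\<close>
definition tb_polyhedron :: "int^2^2 \<Rightarrow> ((real^2) \<times> real) set set \<Rightarrow> bool" where
  "tb_polyhedron A P \<longleftrightarrow> P \<subseteq> tb_space A \<and>
     (\<exists>C. (\<forall>S\<in>C. polytope S) \<and>
          (\<forall>z. \<exists>N. open N \<and> z \<in> N \<and> finite {S\<in>C. S \<inter> N \<noteq> {}}) \<and>
          \<Union>C = \<Union>P)"

text \<open>Spine: a polyhedron whose complement is an open 3-cell.\<close>
definition tb_spine :: "int^2^2 \<Rightarrow> ((real^2) \<times> real) set set \<Rightarrow> bool" where
  "tb_spine A P \<longleftrightarrow> tb_polyhedron A P \<and>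
     subtopology (tb_top A) (tb_space A - P) homeomorphic_space (euclidean :: (real^3) topology)"

end

theory Submission
  imports Defs
begin

text \<open>Write q for the quotient map from R^2 x R onto M(A). Its deck transformations
(x, s) \<mapsto> (A^n x + v, s - n), v \<in> Z^2, move every point they do not fix by a distance of at
least 1, so q restricted to the preimage of an open set U of M(A) is a covering of U. If
U = M(A) - P is an open 3-cell it is simply connected, and q has a continuous section over it.
A loop in F_t missing P therefore lifts to a closed loop in R^2 x R whose height is continuous
and congruent to t modulo 1, hence constant. The lift thus lies in a horizontal plane, which q
maps into F_t, and the straight-line contraction in that plane makes the loop null-homotopic
in F_t.\<close>

(* det A is its own inverse when it is a unit, so det A times the adjugate inverts A. *)
definition int_mat2_inverse :: "int^2^2 \<Rightarrow> int^2^2" where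
  "int_mat2_inverse A = (\<chi> i j. det A *
     (if i = 1 then (if j = 1 then A$2$2 else - A$1$2) else (if j = 1 then - A$2$1 else A$1$1)))"

lemma int_mat2_inverse_mult:
  assumes "\<bar>det A\<bar> = 1"
  shows "A ** int_mat2_inverse A = mat 1" and "int_mat2_inverse A ** A = mat 1"
proof -
  have "det A * det A = 1" using assms by (metis abs_mult_self_eq mult_1)
  then show "A ** int_mat2_inverse A = mat 1" "int_mat2_inverse A ** A = mat 1"
    by (auto simp: vec_eq_iff forall_2 det_2 int_mat2_inverse_def matrix_matrix_mult_def
        mat_def sum_2 algebra_simps)
qed

lemma real_mat_mult: "real_mat (A ** B) = real_mat A ** real_mat B"
  by (simp add: real_mat_def matrix_matrix_mult_def vec_eq_iff)

lemma real_mat_one: "real_mat (mat 1) = mat 1"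
  by (simp add: real_mat_def mat_def vec_eq_iff)

lemma int_lattice_add: "u \<in> int_lattice \<Longrightarrow> v \<in> int_lattice \<Longrightarrow> u + v \<in> int_lattice"
  and int_lattice_minus: "u \<in> int_lattice \<Longrightarrow> - u \<in> int_lattice"
  and int_lattice_zero: "0 \<in> int_lattice"
  by (auto simp: int_lattice_def)

lemma int_lattice_real_mat: "u \<in> int_lattice \<Longrightarrow> real_mat M *v u \<in> int_lattice"
  unfolding int_lattice_def real_mat_def matrix_vector_mult_def
  by (auto intro!: Ints_sum Ints_mult)

definition monodromy_pow :: "int^2^2 \<Rightarrow> int \<Rightarrow> real^2 \<Rightarrow> real^2" where
  "monodromy_pow A n = (if 0 \<le> n then (*v) (real_mat A) ^^ nat n
                        else (*v) (real_mat (int_mat2_inverse A)) ^^ nat (- n))"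

lemma monodromy_pow_of_nat: "monodromy_pow A (int k) = (*v) (real_mat A) ^^ k"
  by (simp add: monodromy_pow_def)

lemma monodromy_pow_0 [simp]: "monodromy_pow A 0 x = x"
  by (simp add: monodromy_pow_def)

lemma linear_monodromy_pow: "linear (monodromy_pow A n)"
proof -
  have "linear (f ^^ k)" if "linear f" for f :: "real^2 \<Rightarrow> real^2" and k
    using that by (induction k) (auto intro: linear_compose bounded_linear.linear simp: id_def)
  then show ?thesis
    by (simp add: monodromy_pow_def matrix_vector_mul_linear)
qed

lemma int_lattice_monodromy_pow: "u \<in> int_lattice \<Longrightarrow> monodromy_pow A n u \<in> int_lattice"
proof -
  have "(f ^^ k) u \<in> int_lattice" if "\<And>u. u \<in> int_lattice \<Longrightarrow> f u \<in> int_lattice"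
    and "u \<in> int_lattice" for f :: "real^2 \<Rightarrow> real^2" and k u
    using that by (induction k) auto
  then show "u \<in> int_lattice \<Longrightarrow> monodromy_pow A n u \<in> int_lattice"
    by (simp add: monodromy_pow_def int_lattice_real_mat)
qed

context
  fixes A :: "int^2^2"
  assumes unimodular: "\<bar>det A\<bar> = 1"
begin

lemma monodromy_pow_succ: "monodromy_pow A (n + 1) x = real_mat A *v monodromy_pow A n x"
proof -
  have cancel: "real_mat A *v (real_mat (int_mat2_inverse A) *v y) = y" for y
    by (simp add: matrix_vector_mul_assoc int_mat2_inverse_mult[OF unimodular] real_mat_one
        flip: real_mat_mult)
  consider "0 \<le> n" | "n = -1" | "n < -1" by linarith
  then show ?thesis
  proof cases
    case 1
    then have "nat (n + 1) = Suc (nat n)" by simp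
    with 1 show ?thesis by (simp add: monodromy_pow_def)
  next
    case 2
    then show ?thesis by (simp add: monodromy_pow_def cancel)
  next
    case 3
    then have "nat (- n) = Suc (nat (- (n + 1)))" by simp
    with 3 show ?thesis by (simp add: monodromy_pow_def cancel)
  qed
qed

lemma monodromy_pow_pred:
  "monodromy_pow A (n - 1) x = real_mat (int_mat2_inverse A) *v monodromy_pow A n x"
  using monodromy_pow_succ[of "n - 1" x]
  by (simp add: matrix_vector_mul_assoc int_mat2_inverse_mult[OF unimodular] real_mat_one
      flip: real_mat_mult)

lemma monodromy_pow_add: "monodromy_pow A m (monodromy_pow A n x) = monodromy_pow A (m + n) x"
proof (induction m rule: int_induct[where k = 0])
  case (step1 i)
  then show ?case using monodromy_pow_succ[of i] monodromy_pow_succ[of "i + n"]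
    by (simp add: algebra_simps)
next
  case (step2 i)
  then show ?case using monodromy_pow_pred[of i] monodromy_pow_pred[of "i + n"]
    by (simp add: algebra_simps)
qed simp

end

definition tb_deck :: "int^2^2 \<Rightarrow> int \<Rightarrow> real^2 \<Rightarrow> (real^2) \<times> real \<Rightarrow> (real^2) \<times> real" where
  "tb_deck A n v z = (monodromy_pow A n (fst z) + v, snd z - of_int n)"

definition tb_decks :: "int^2^2 \<Rightarrow> ((real^2) \<times> real \<Rightarrow> (real^2) \<times> real) set" where
  "tb_decks A = {tb_deck A n v | n v. v \<in> int_lattice}"

lemma id_in_tb_decks: "(\<lambda>z. z) \<in> tb_decks A"
  using int_lattice_zero unfolding tb_decks_def by (force simp: fun_eq_iff tb_deck_def)

lemma continuous_on_tb_deck: "d \<in> tb_decks A \<Longrightarrow> continuous_on UNIV d"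
proof -
  have pow: "continuous_on UNIV (monodromy_pow A n)" for n
    using linear_monodromy_pow by (simp add: linear_continuous_on linear_conv_bounded_linear)
  show "d \<in> tb_decks A \<Longrightarrow> continuous_on UNIV d"
    by (auto simp: tb_decks_def tb_deck_def intro!: continuous_intros continuous_on_compose2[OF pow])
qed

lemma tb_deck_eqI:
  assumes "d \<in> tb_decks A" "d' \<in> tb_decks A" "d z = d' z"
  shows "d = d'"
  using assms by (auto simp: tb_decks_def tb_deck_def)

lemma dist_tb_deck_ge_1:
  assumes "d \<in> tb_decks A" "d z \<noteq> z"
  shows "1 \<le> dist z (d z)"
proof -
  obtain n v where v: "v \<in> int_lattice" and d: "d = tb_deck A n v"
    using assms(1) by (auto simp: tb_decks_def)
  show ?thesis
  proof (cases "n = 0")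
    case False
    then have "1 \<le> \<bar>snd z - snd (d z)\<bar>" by (simp add: d tb_deck_def)
    also have "\<dots> \<le> dist z (d z)"
      by (metis dist_real_def dist_snd_le)
    finally show ?thesis .
  next
    case True
    then have dz: "d z = (fst z + v, snd z)" by (simp add: d tb_deck_def)
    then have "v \<noteq> 0" using assms(2) by auto
    then obtain i where i: "v $ i \<noteq> 0" by (auto simp: vec_eq_iff)
    have "1 \<le> \<bar>v $ i\<bar>" using i v by (intro Ints_nonzero_abs_ge1) (auto simp: int_lattice_def)
    also have "\<dots> \<le> norm v" by (rule component_le_norm_cart)
    also have "\<dots> = norm (z - d z)" by (simp add: dz minus_prod_def norm_Pair)
    also have "\<dots> = dist z (d z)" by (simp add: dist_norm)
    finally show ?thesis .
  qed
qed

context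
  fixes A :: "int^2^2"
  assumes unimodular: "\<bar>det A\<bar> = 1"
begin

lemma tb_decks_comp:
  assumes "d \<in> tb_decks A" "d' \<in> tb_decks A"
  shows "d \<circ> d' \<in> tb_decks A"
proof -
  obtain m w n v where "w \<in> int_lattice" "d = tb_deck A m w" "v \<in> int_lattice" "d' = tb_deck A n v"
    using assms by (auto simp: tb_decks_def)
  moreover have "tb_deck A m w \<circ> tb_deck A n v = tb_deck A (m + n) (monodromy_pow A m v + w)"
    using monodromy_pow_add[OF unimodular] linear_add[OF linear_monodromy_pow]
    by (simp add: fun_eq_iff tb_deck_def algebra_simps)
  ultimately show ?thesis
    unfolding tb_decks_def by (blast intro: int_lattice_add int_lattice_monodromy_pow)
qed

lemma tb_deck_inverse:
  "tb_deck A (- n) (- monodromy_pow A (- n) v) (tb_deck A n v z) = z"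
  using monodromy_pow_add[OF unimodular, of "- n" n] linear_add[OF linear_monodromy_pow]
  by (simp add: tb_deck_def prod_eq_iff)

lemma tb_decks_inverse:
  assumes "d \<in> tb_decks A"
  obtains d' where "d' \<in> tb_decks A" "\<And>z. d' (d z) = z" "\<And>z. d (d' z) = z"
proof -
  obtain n v where v: "v \<in> int_lattice" and d: "d = tb_deck A n v"
    using assms by (auto simp: tb_decks_def)
  define d' where "d' = tb_deck A (- n) (- monodromy_pow A (- n) v)"
  have d'_in: "d' \<in> tb_decks A"
    unfolding tb_decks_def d'_def using v by (blast intro: int_lattice_minus int_lattice_monodromy_pow)
  have left: "d' (d z) = z" for z
    by (simp add: d d'_def tb_deck_inverse)
  have "d \<circ> d' = (\<lambda>z. z)"
    using tb_deck_eqI[OF tb_decks_comp[OF assms d'_in] id_in_tb_decks, of "d 0"] left by simp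
  then have "d (d' z) = z" for z by (metis comp_apply)
  with d'_in left show ?thesis by (rule that)
qed

lemma tb_decks_eq_if_dist_less_1:
  assumes "d \<in> tb_decks A" "d' \<in> tb_decks A" "dist (d z) (d' z) < 1"
  shows "d = d'"
proof -
  obtain e where e: "e \<in> tb_decks A" "\<And>z. e (d z) = z" "\<And>z. d (e z) = z"
    using tb_decks_inverse[OF assms(1)] by blast
  have "(d' \<circ> e) (d z) = d' z" by (simp add: e)
  then have "d' z = d z"
    using dist_tb_deck_ge_1[OF tb_decks_comp[OF assms(2) e(1)], of "d z"] assms(3) by fastforce
  then show ?thesis using tb_deck_eqI[OF assms(1,2), of z] by simp
qed

lemma tb_rel_iff: "(z, w) \<in> tb_rel A \<longleftrightarrow> (\<exists>d\<in>tb_decks A. w = d z)"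
proof -
  have pow: "((*v) (real_mat A) ^^ k) x = monodromy_pow A (int k) x" for k x
    by (simp add: monodromy_pow_of_nat)
  have "(z, w) \<in> tb_rel A \<longleftrightarrow>
      (\<exists>k::nat. \<exists>v\<in>int_lattice. w = tb_deck A (int k) v z \<or> z = tb_deck A (int k) v w)"
    by (cases z; cases w) (simp add: tb_rel_def tb_deck_def pow)
  also have "\<dots> \<longleftrightarrow> (\<exists>n. \<exists>v\<in>int_lattice. w = tb_deck A n v z)"
  proof
    assume "\<exists>k::nat. \<exists>v\<in>int_lattice. w = tb_deck A (int k) v z \<or> z = tb_deck A (int k) v w"
    then obtain k v where v: "v \<in> int_lattice" and
      kv: "w = tb_deck A (int k) v z \<or> z = tb_deck A (int k) v w" by blast
    have "w = tb_deck A (- k) (- monodromy_pow A (- k) v) z" if "z = tb_deck A (int k) v w"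
      using that tb_deck_inverse by simp
    with kv v show "\<exists>n. \<exists>v\<in>int_lattice. w = tb_deck A n v z"
      by (metis int_lattice_minus int_lattice_monodromy_pow)
  next
    assume "\<exists>n. \<exists>v\<in>int_lattice. w = tb_deck A n v z"
    then obtain n v where v: "v \<in> int_lattice" and w: "w = tb_deck A n v z" by blast
    show "\<exists>k::nat. \<exists>v\<in>int_lattice. w = tb_deck A (int k) v z \<or> z = tb_deck A (int k) v w"
    proof (cases "0 \<le> n")
      case True
      with v w show ?thesis by (intro exI[of _ "nat n"] bexI[of _ v]) simp_all
    next
      case False
      have "z = tb_deck A (- n) (- monodromy_pow A (- n) v) w"
        using w tb_deck_inverse by simp
      with False v show ?thesis
        by (intro exI[of _ "nat (- n)"] bexI[of _ "- monodromy_pow A (- n) v"])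
          (simp_all add: int_lattice_minus int_lattice_monodromy_pow)
    qed
  qed
  finally show ?thesis unfolding tb_decks_def by blast
qed

lemma equiv_tb_rel: "equiv UNIV (tb_rel A)"
proof (rule equivI)
  show "refl (tb_rel A)"
    using id_in_tb_decks by (auto simp: refl_on_def tb_rel_iff)
  show "sym (tb_rel A)"
    by (rule symI) (metis tb_rel_iff tb_decks_inverse)
  show "trans (tb_rel A)"
    by (rule transI) (metis tb_rel_iff tb_decks_comp comp_apply)
qed auto

end

definition tb_class :: "int^2^2 \<Rightarrow> (real^2) \<times> real \<Rightarrow> ((real^2) \<times> real) set" where
  "tb_class A z = tb_rel A `` {z}"

context
  fixes A :: "int^2^2"
  assumes unimodular: "\<bar>det A\<bar> = 1"
begin

lemma mem_tb_class: "z \<in> tb_class A z"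
  unfolding tb_class_def by (rule equiv_class_self[OF equiv_tb_rel[OF unimodular]]) simp

lemma tb_class_eq_iff: "tb_class A z = tb_class A w \<longleftrightarrow> (\<exists>d\<in>tb_decks A. w = d z)"
  unfolding tb_class_def eq_equiv_class_iff[OF equiv_tb_rel[OF unimodular] UNIV_I UNIV_I]
  by (rule tb_rel_iff[OF unimodular])

lemma tb_class_tb_deck: "d \<in> tb_decks A \<Longrightarrow> tb_class A (d z) = tb_class A z"
  using tb_class_eq_iff by blast

lemma tb_space_eq_range: "tb_space A = range (tb_class A)"
  unfolding tb_space_def tb_class_def quotient_def by blast

lemma tb_space_elem_eq_tb_class:
  assumes "c \<in> tb_space A" "z \<in> c"
  shows "c = tb_class A z"
proof -
  obtain x where x: "c = tb_class A x" using assms(1) tb_space_eq_range by blast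
  then have "(x, z) \<in> tb_rel A" using assms(2) by (simp add: tb_class_def)
  then show ?thesis unfolding x tb_class_def by (rule equiv_class_eq[OF equiv_tb_rel[OF unimodular]])
qed

lemma Union_eq_vimage_tb_class: "U \<subseteq> tb_space A \<Longrightarrow> \<Union>U = tb_class A -` U"
  using tb_space_elem_eq_tb_class mem_tb_class by blast

lemma openin_tb_top: "openin (tb_top A) U \<longleftrightarrow> U \<subseteq> tb_space A \<and> open (\<Union>U)"
proof -
  have "istopology (\<lambda>U. U \<subseteq> tb_space A \<and> open (\<Union>U))"
    unfolding istopology_def
  proof (rule conjI; intro allI impI)
    fix S T assume "S \<subseteq> tb_space A \<and> open (\<Union>S)" "T \<subseteq> tb_space A \<and> open (\<Union>T)"
    moreover have "\<Union>(S \<inter> T) = \<Union>S \<inter> \<Union>T" if "S \<subseteq> tb_space A" "T \<subseteq> tb_space A"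
      using that by (simp add: Union_eq_vimage_tb_class le_infI1 vimage_Int)
    ultimately show "S \<inter> T \<subseteq> tb_space A \<and> open (\<Union>(S \<inter> T))" by auto
  next
    fix K assume "\<forall>S\<in>K. S \<subseteq> tb_space A \<and> open (\<Union>S)"
    moreover have "\<Union>(\<Union>K) = (\<Union>S\<in>K. \<Union>S)" by blast
    ultimately show "\<Union>K \<subseteq> tb_space A \<and> open (\<Union>(\<Union>K))" by auto
  qed
  then show ?thesis by (simp add: tb_top_def)
qed

lemma topspace_tb_top: "topspace (tb_top A) = tb_space A"
proof -
  have "openin (tb_top A) (tb_space A)"
    by (simp add: openin_tb_top tb_space_eq_range Union_eq_vimage_tb_class vimage_def)
  then have "tb_space A \<subseteq> topspace (tb_top A)" by (rule openin_subset)
  moreover have "topspace (tb_top A) \<subseteq> tb_space A" unfolding topspace_def openin_tb_top by blast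
  ultimately show ?thesis by blast
qed

lemma continuous_map_tb_class: "continuous_map euclidean (tb_top A) (tb_class A)"
  unfolding continuous_map_def
  by (auto simp: topspace_tb_top tb_space_eq_range openin_tb_top Union_eq_vimage_tb_class vimage_def)

lemma openin_tb_top_image:
  assumes "open Q"
  shows "openin (tb_top A) (tb_class A ` Q)"
proof -
  have "tb_class A -` tb_class A ` Q = (\<Union>d\<in>tb_decks A. d -` Q)"
  proof (rule set_eqI)
    fix x
    have "x \<in> tb_class A -` tb_class A ` Q \<longleftrightarrow> (\<exists>q\<in>Q. tb_class A x = tb_class A q)" by auto
    also have "\<dots> \<longleftrightarrow> (\<exists>d\<in>tb_decks A. d x \<in> Q)" by (auto simp: tb_class_eq_iff)
    finally show "x \<in> tb_class A -` tb_class A ` Q \<longleftrightarrow> x \<in> (\<Union>d\<in>tb_decks A. d -` Q)" by simp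
  qed
  moreover have "open (d -` Q)" if "d \<in> tb_decks A" for d
    using continuous_on_tb_deck[OF that] assms by (simp add: continuous_on_open_vimage)
  moreover have "tb_class A ` Q \<subseteq> tb_space A" by (simp add: tb_space_eq_range image_subsetI)
  ultimately show ?thesis by (simp add: openin_tb_top Union_eq_vimage_tb_class open_UN)
qed

lemma tb_class_in_fiber_iff: "tb_class A z \<in> tb_fiber A t \<longleftrightarrow> frac (snd z) = frac t"
proof -
  have "(SOME x. x \<in> tb_class A z) \<in> tb_class A z" by (rule someI) (rule mem_tb_class)
  then obtain d where "d \<in> tb_decks A" and some: "(SOME x. x \<in> tb_class A z) = d z"
    by (auto simp: tb_class_def tb_rel_iff[OF unimodular])
  then obtain n v where "snd (d z) = snd z + of_int (- n)"
    by (auto simp: tb_decks_def tb_deck_def)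
  then have "tb_proj (tb_class A z) = frac (snd z)"
    unfolding tb_proj_def some by (simp only: frac_add_of_int_right)
  then show ?thesis by (simp add: tb_fiber_def tb_space_eq_range)
qed

end

lemma tb_deck_homeomorphism:
  assumes "\<bar>det A\<bar> = 1" "d \<in> tb_decks A"
  obtains d' where "homeomorphism UNIV UNIV d d'"
proof -
  obtain d' where "d' \<in> tb_decks A" "\<And>z. d' (d z) = z" "\<And>z. d (d' z) = z"
    using tb_decks_inverse[OF assms] by blast
  then have "homeomorphism UNIV UNIV d d'"
    using continuous_on_tb_deck assms(2) by (intro homeomorphismI) auto
  then show ?thesis by (rule that)
qed

lemma dist_less_twice_radius_of_mem_ball: "a \<in> ball z e \<Longrightarrow> b \<in> ball z e \<Longrightarrow> dist a b < 2 * e"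
  by (metis dist_commute dist_triangle_less_add mem_ball mult_2)

lemma pairwise_disjnt_tb_deck_vimage_ball:
  assumes "\<bar>det A\<bar> = 1" "e \<le> 1/2"
  shows "pairwise disjnt ((\<lambda>d. d -` ball z e) ` tb_decks A)"
proof (rule pairwise_imageI)
  fix d d' assume d: "d \<in> tb_decks A" "d' \<in> tb_decks A" "d -` ball z e \<noteq> d' -` ball z e"
  have "d = d'" if "x \<in> d -` ball z e" "x \<in> d' -` ball z e" for x
    using that assms(2) dist_less_twice_radius_of_mem_ball[of "d x" z e "d' x"]
    by (intro tb_decks_eq_if_dist_less_1[OF assms(1) d(1,2), of x]) auto
  with d(3) show "disjnt (d -` ball z e) (d' -` ball z e)" unfolding disjnt_iff by blast
qed

locale tb_chart =
  fixes A :: "int^2^2" and U :: "((real^2) \<times> real) set set"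
    and \<phi> :: "((real^2) \<times> real) set \<Rightarrow> 'b::topological_space"
    and \<psi> :: "'b \<Rightarrow> ((real^2) \<times> real) set"
  assumes unimodular: "\<bar>det A\<bar> = 1"
    and open_U: "openin (tb_top A) U"
    and homeo: "homeomorphic_maps (subtopology (tb_top A) U) euclidean \<phi> \<psi>"
begin

lemma topspace_U: "topspace (subtopology (tb_top A) U) = U"
  using openin_subset[OF open_U] by auto

lemma mem_Union_iff: "z \<in> \<Union>U \<longleftrightarrow> tb_class A z \<in> U"
proof -
  have "U \<subseteq> tb_space A" using open_U by (simp add: openin_tb_top[OF unimodular])
  then have "\<Union>U = tb_class A -` U" by (rule Union_eq_vimage_tb_class[OF unimodular])
  then show ?thesis by (simp only: vimage_eq)
qed

lemma chart_inverse_in_U: "\<psi> y \<in> U"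
  using homeo continuous_map_image_subset_topspace[of euclidean "subtopology (tb_top A) U" \<psi>]
  by (auto simp: homeomorphic_maps_def topspace_U)

lemma chart_inj: "c \<in> U \<Longrightarrow> c' \<in> U \<Longrightarrow> \<phi> c = \<phi> c' \<Longrightarrow> c = c'"
  using homeo topspace_U by (metis homeomorphic_maps_def)

lemma continuous_on_chart_tb_class: "continuous_on (\<Union>U) (\<phi> \<circ> tb_class A)"
proof -
  have "continuous_map (top_of_set (\<Union>U)) (subtopology (tb_top A) U) (tb_class A)"
    using continuous_map_from_subtopology[OF continuous_map_tb_class[OF unimodular]] mem_Union_iff
    by (auto simp: continuous_map_in_subtopology)
  then have "continuous_map (top_of_set (\<Union>U)) euclidean (\<phi> \<circ> tb_class A)"
    by (rule continuous_map_compose) (use homeo in \<open>simp add: homeomorphic_maps_def\<close>)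
  then show ?thesis by simp
qed

lemma open_chart_tb_class_image:
  assumes "open Q" "Q \<subseteq> \<Union>U"
  shows "open ((\<phi> \<circ> tb_class A) ` Q)"
proof -
  have "openin (subtopology (tb_top A) U) (tb_class A ` Q)"
  proof -
    have "tb_class A ` Q \<subseteq> U" using assms(2) mem_Union_iff by blast
    then have "tb_class A ` Q = tb_class A ` Q \<inter> U" by blast
    with openin_tb_top_image[OF unimodular assms(1)] show ?thesis
      unfolding openin_subtopology by blast
  qed
  moreover have "open_map (subtopology (tb_top A) U) euclidean \<phi>"
    using homeo homeomorphic_imp_open_map homeomorphic_map_maps by blast
  ultimately have "open (\<phi> ` tb_class A ` Q)" by (simp add: open_map_def)
  then show ?thesis by (simp only: image_comp)
qed

lemma chart_tb_class_tb_deck: "d \<in> tb_decks A \<Longrightarrow> (\<phi> \<circ> tb_class A) \<circ> d = \<phi> \<circ> tb_class A"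
  by (simp add: fun_eq_iff tb_class_tb_deck[OF unimodular])

lemma homeomorphism_chart_tb_class_ball:
  assumes "e \<le> 1/2" "ball z e \<subseteq> \<Union>U"
  obtains q where "homeomorphism (ball z e) ((\<phi> \<circ> tb_class A) ` ball z e) (\<phi> \<circ> tb_class A) q"
proof (rule homeomorphism_injective_open_map)
  show "continuous_on (ball z e) (\<phi> \<circ> tb_class A)"
    using continuous_on_chart_tb_class assms(2) by (rule continuous_on_subset)
  show "inj_on (\<phi> \<circ> tb_class A) (ball z e)"
  proof (rule inj_onI)
    fix x y assume xy: "x \<in> ball z e" "y \<in> ball z e" "(\<phi> \<circ> tb_class A) x = (\<phi> \<circ> tb_class A) y"
    moreover have "tb_class A x \<in> U" "tb_class A y \<in> U"
      using xy(1,2) assms(2) mem_Union_iff by blast+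
    ultimately have "tb_class A x = tb_class A y" using chart_inj by simp
    then obtain d where d: "d \<in> tb_decks A" "y = d x" using tb_class_eq_iff[OF unimodular] by blast
    have "dist (d x) x < 1" using dist_less_twice_radius_of_mem_ball[OF xy(2,1)] d(2) assms(1) by simp
    then have "d = (\<lambda>x. x)"
      by (intro tb_decks_eq_if_dist_less_1[OF unimodular d(1) id_in_tb_decks])
    with d show "x = y" by simp
  qed
  fix V assume "openin (top_of_set (ball z e)) V"
  then have V: "open V" "V \<subseteq> ball z e" by (simp_all add: openin_open_eq)
  show "openin (top_of_set ((\<phi> \<circ> tb_class A) ` ball z e)) ((\<phi> \<circ> tb_class A) ` V)"
  proof (rule open_subset)
    show "(\<phi> \<circ> tb_class A) ` V \<subseteq> (\<phi> \<circ> tb_class A) ` ball z e" using V(2) by (rule image_mono)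
    show "open ((\<phi> \<circ> tb_class A) ` V)"
      using V assms(2) by (intro open_chart_tb_class_image) auto
  qed
qed (rule refl)

lemma chart_tb_class_surj:
  obtains z where "z \<in> \<Union>U" "(\<phi> \<circ> tb_class A) z = y"
proof -
  have "\<psi> y \<in> tb_space A" using chart_inverse_in_U open_U by (auto simp: openin_tb_top[OF unimodular])
  then obtain z where z: "\<psi> y = tb_class A z" by (auto simp: tb_space_eq_range[OF unimodular])
  show ?thesis
  proof
    show "z \<in> \<Union>U" by (metis chart_inverse_in_U mem_Union_iff z)
    show "(\<phi> \<circ> tb_class A) z = y" using homeo z by (simp add: homeomorphic_maps_def flip: z)
  qed
qed

lemma tb_deck_vimage_subset:
  assumes "d \<in> tb_decks A" "B \<subseteq> \<Union>U"
  shows "d -` B \<subseteq> \<Union>U"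
proof
  fix x assume "x \<in> d -` B"
  then have "tb_class A (d x) \<in> U" using assms(2) mem_Union_iff by blast
  then show "x \<in> \<Union>U" using mem_Union_iff tb_class_tb_deck[OF unimodular assms(1)] by simp
qed

lemma Union_tb_deck_vimage_ball:
  assumes "ball z e \<subseteq> \<Union>U"
  shows "(\<Union>d\<in>tb_decks A. d -` ball z e) = \<Union>U \<inter> (\<phi> \<circ> tb_class A) -` (\<phi> \<circ> tb_class A) ` ball z e"
proof
  show "(\<Union>d\<in>tb_decks A. d -` ball z e) \<subseteq> \<Union>U \<inter> (\<phi> \<circ> tb_class A) -` (\<phi> \<circ> tb_class A) ` ball z e"
  proof
    fix x assume "x \<in> (\<Union>d\<in>tb_decks A. d -` ball z e)"
    then obtain d where d: "d \<in> tb_decks A" "d x \<in> ball z e" by blast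
    then have "tb_class A x = tb_class A (d x)" by (simp add: tb_class_tb_deck[OF unimodular])
    moreover have "x \<in> \<Union>U" using tb_deck_vimage_subset[OF d(1) assms] d(2) by blast
    ultimately show "x \<in> \<Union>U \<inter> (\<phi> \<circ> tb_class A) -` (\<phi> \<circ> tb_class A) ` ball z e"
      using d(2) by auto
  qed
  show "\<Union>U \<inter> (\<phi> \<circ> tb_class A) -` (\<phi> \<circ> tb_class A) ` ball z e \<subseteq> (\<Union>d\<in>tb_decks A. d -` ball z e)"
  proof
    fix x assume x: "x \<in> \<Union>U \<inter> (\<phi> \<circ> tb_class A) -` (\<phi> \<circ> tb_class A) ` ball z e"
    then obtain b where b: "b \<in> ball z e" "\<phi> (tb_class A x) = \<phi> (tb_class A b)" by auto
    moreover have "tb_class A x \<in> U" "tb_class A b \<in> U"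
      using x b(1) assms mem_Union_iff by blast+
    ultimately have "tb_class A x = tb_class A b" using chart_inj by simp
    then obtain d where "d \<in> tb_decks A" "b = d x" using tb_class_eq_iff[OF unimodular] by blast
    with b(1) show "x \<in> (\<Union>d\<in>tb_decks A. d -` ball z e)" by auto
  qed
qed

lemma homeomorphism_tb_deck_vimage_ball:
  assumes "d \<in> tb_decks A" "e \<le> 1/2" "ball z e \<subseteq> \<Union>U"
  obtains q where
    "homeomorphism (d -` ball z e) ((\<phi> \<circ> tb_class A) ` ball z e) (\<phi> \<circ> tb_class A) q"
proof -
  obtain d' where dd': "homeomorphism UNIV UNIV d d'" using tb_deck_homeomorphism[OF unimodular assms(1)] .
  moreover have "d ` (d -` ball z e) = ball z e"
    using dd' unfolding homeomorphism_def by (simp add: image_vimage_eq)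
  ultimately have "homeomorphism (d -` ball z e) (ball z e) d d'"
    by (intro homeomorphism_of_subsets[OF dd']) auto
  moreover obtain q where "homeomorphism (ball z e) ((\<phi> \<circ> tb_class A) ` ball z e) (\<phi> \<circ> tb_class A) q"
    using homeomorphism_chart_tb_class_ball[OF assms(2,3)] .
  ultimately have "homeomorphism (d -` ball z e) ((\<phi> \<circ> tb_class A) ` ball z e)
      ((\<phi> \<circ> tb_class A) \<circ> d) (d' \<circ> q)"
    by (rule homeomorphism_compose)
  with that show ?thesis by (simp add: chart_tb_class_tb_deck[OF assms(1)])
qed

lemma covering_space_chart_tb_class: "covering_space (\<Union>U) (\<phi> \<circ> tb_class A) UNIV"
proof
  show "continuous_on (\<Union>U) (\<phi> \<circ> tb_class A)" by (rule continuous_on_chart_tb_class)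
  show "(\<phi> \<circ> tb_class A) ` \<Union>U = UNIV" using chart_tb_class_surj by (metis imageI UNIV_eq_I)
  fix y :: 'b
  obtain z where z: "z \<in> \<Union>U" "(\<phi> \<circ> tb_class A) z = y" by (rule chart_tb_class_surj)
  have "open (\<Union>U)" using open_U by (simp add: openin_tb_top[OF unimodular])
  then obtain e0 where "0 < e0" "ball z e0 \<subseteq> \<Union>U" using z(1) open_contains_ball by blast
  then obtain e where e: "0 < e" "e \<le> 1/2" "ball z e \<subseteq> \<Union>U"
    by (intro that[of "min e0 (1/2)"]) auto
  let ?T = "(\<phi> \<circ> tb_class A) ` ball z e"
  let ?V = "(\<lambda>d. d -` ball z e) ` tb_decks A"
  show "\<exists>T. y \<in> T \<and> openin (top_of_set UNIV) T \<and>
      (\<exists>v. \<Union>v = \<Union>U \<inter> (\<phi> \<circ> tb_class A) -` T \<and> (\<forall>u\<in>v. openin (top_of_set (\<Union>U)) u) \<and>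
           pairwise disjnt v \<and> (\<forall>u\<in>v. \<exists>q. homeomorphism u T (\<phi> \<circ> tb_class A) q))"
  proof (intro exI[of _ ?T] exI[of _ ?V] conjI ballI)
    show "y \<in> ?T" using z(2) e(1) by force
    show "openin (top_of_set UNIV) ?T" using open_chart_tb_class_image e(3) by simp
    show "\<Union>?V = \<Union>U \<inter> (\<phi> \<circ> tb_class A) -` ?T" by (simp add: Union_tb_deck_vimage_ball[OF e(3)])
    show "pairwise disjnt ?V" using pairwise_disjnt_tb_deck_vimage_ball[OF unimodular e(2)] .
  next
    fix u assume "u \<in> ?V"
    then obtain d where d: "d \<in> tb_decks A" and u: "u = d -` ball z e" by blast
    show "openin (top_of_set (\<Union>U)) u"
      unfolding u using tb_deck_vimage_subset[OF d e(3)] continuous_on_tb_deck[OF d]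
      by (intro open_subset) (auto simp: continuous_on_open_vimage)
    show "\<exists>q. homeomorphism u ?T (\<phi> \<circ> tb_class A) q"
      unfolding u using homeomorphism_tb_deck_vimage_ball[OF d e(2,3)] by blast
  qed
qed

end

lemma closedin_tb_top:
  assumes "\<bar>det A\<bar> = 1"
  shows "closedin (tb_top A) P \<longleftrightarrow> P \<subseteq> tb_space A \<and> closed (\<Union>P)"
proof -
  have "\<Union>(tb_space A - P) = - \<Union>P" if "P \<subseteq> tb_space A"
  proof -
    have "\<Union>P = tb_class A -` P" "\<Union>(tb_space A - P) = tb_class A -` (tb_space A - P)"
      using that by (simp_all add: Union_eq_vimage_tb_class[OF assms])
    then show ?thesis by (auto simp: tb_space_eq_range[OF assms])
  qed
  then show ?thesis
    by (auto simp: closedin_def closed_def topspace_tb_top[OF assms] openin_tb_top[OF assms])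
qed

lemma closedin_tb_polyhedron:
  assumes "\<bar>det A\<bar> = 1" "tb_polyhedron A P"
  shows "closedin (tb_top A) P"
proof -
  obtain C where C: "\<And>S. S \<in> C \<Longrightarrow> polytope S" "locally_finite_in euclidean C" "\<Union>C = \<Union>P"
    and "P \<subseteq> tb_space A"
    using assms(2) by (auto simp: tb_polyhedron_def locally_finite_in_def)
  moreover have "closedin euclidean (\<Union>C)"
    using C(1,2) by (intro closedin_locally_finite_Union) (auto simp: polytope_imp_closed)
  ultimately show ?thesis by (simp add: closedin_tb_top[OF assms(1)])
qed

lemma tb_class_section:
  fixes A :: "int^2^2"
  assumes unimodular: "\<bar>det A\<bar> = 1" and open_U: "openin (tb_top A) U"
    and cell: "subtopology (tb_top A) U homeomorphic_space (euclidean :: 'b::real_normed_vector topology)"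
  obtains s where "continuous_map (subtopology (tb_top A) U) euclidean s"
    and "\<And>c. c \<in> U \<Longrightarrow> tb_class A (s c) = c"
proof -
  obtain \<phi> :: "_ \<Rightarrow> 'b" and \<psi> where homeo: "homeomorphic_maps (subtopology (tb_top A) U) euclidean \<phi> \<psi>"
    using cell unfolding homeomorphic_space_def by blast
  interpret tb_chart A U \<phi> \<psi> using unimodular open_U homeo by unfold_locales
  obtain s' where s': "continuous_on UNIV s'" "s' \<in> UNIV \<rightarrow> \<Union>U" "\<And>y. (\<phi> \<circ> tb_class A) (s' y) = y"
  proof (rule covering_space_lift[OF covering_space_chart_tb_class])
    show "simply_connected (UNIV :: 'b set)" by (simp add: convex_imp_simply_connected)
    show "locally path_connected (UNIV :: 'b set)" by (rule locally_path_connected_UNIV)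
  qed (auto intro: continuous_on_id)
  show ?thesis
  proof
    show "continuous_map (subtopology (tb_top A) U) euclidean (s' \<circ> \<phi>)"
      using homeo s'(1) by (auto simp: homeomorphic_maps_def intro: continuous_map_compose)
    fix c assume c: "c \<in> U"
    have "tb_class A (s' (\<phi> c)) \<in> U" using s'(2) mem_Union_iff by blast
    then show "tb_class A ((s' \<circ> \<phi>) c) = c" using chart_inj c s'(3) by simp
  qed
qed

lemma tb_spine_section:
  assumes "\<bar>det A\<bar> = 1" "tb_spine A P"
  obtains s where "continuous_map (subtopology (tb_top A) (tb_space A - P)) euclidean s"
    and "\<And>c. c \<in> tb_space A - P \<Longrightarrow> tb_class A (s c) = c"
proof -
  have "openin (tb_top A) (tb_space A - P)"
    using closedin_tb_polyhedron[OF assms(1)] assms(2)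
    by (simp add: tb_spine_def closedin_def topspace_tb_top[OF assms(1)])
  then show ?thesis
    using tb_class_section[OF assms(1)] assms(2) that unfolding tb_spine_def by blast
qed

lemma continuous_on_Ints_valued_imp_constant:
  fixes f :: "'a::topological_space \<Rightarrow> real"
  assumes "connected S" "continuous_on S f" "\<And>x. x \<in> S \<Longrightarrow> f x \<in> \<int>"
  shows "f constant_on S"
proof (rule continuous_discrete_range_constant[OF assms(1,2)])
  fix x assume "x \<in> S"
  then have "1 \<le> norm (f y - f x)" if "y \<in> S" "f y \<noteq> f x" for y
    using that assms(3) by (simp add: Ints_nonzero_abs_ge1)
  then show "\<exists>e>0. \<forall>y. y \<in> S \<and> f y \<noteq> f x \<longrightarrow> e \<le> norm (f y - f x)"
    by (intro exI[of _ 1]) auto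
qed

lemma convex_horizontal_plane: "convex {z :: 'a::real_vector \<times> real. snd z = c}"
  by (auto simp: convex_def simp flip: distrib_right)

lemma snd_path_in_tb_fiber_constant:
  assumes unimodular: "\<bar>det A\<bar> = 1" and "path \<gamma>"
    and in_fiber: "\<And>r. r \<in> {0..1} \<Longrightarrow> tb_class A (\<gamma> r) \<in> tb_fiber A t"
    and "s \<in> {0..1}"
  shows "snd (\<gamma> s) = snd (\<gamma> 0)"
proof -
  have "snd (\<gamma> r) - snd (\<gamma> 0) \<in> \<int>" if r: "r \<in> {0..1}" for r
  proof -
    have "frac (snd (\<gamma> r)) = frac (snd (\<gamma> 0))"
      using in_fiber[OF r] in_fiber[of 0] by (simp add: tb_class_in_fiber_iff[OF unimodular])
    then obtain n where "snd (\<gamma> r) = snd (\<gamma> 0) + of_int n" by (rule frac_eqE)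
    then show ?thesis by simp
  qed
  then have "(\<lambda>r. snd (\<gamma> r) - snd (\<gamma> 0)) constant_on {0..1}"
    using \<open>path \<gamma>\<close> unfolding path_def
    by (intro continuous_on_Ints_valued_imp_constant) (auto intro!: continuous_intros)
  then obtain y where "\<And>r. r \<in> {0..1} \<Longrightarrow> snd (\<gamma> r) - snd (\<gamma> 0) = y"
    by (auto simp: constant_on_def)
  from this[OF \<open>s \<in> {0..1}\<close>] this[of 0] show ?thesis by simp
qed

lemma lifted_loop_in_fiber_nullhomotopic:
  assumes unimodular: "\<bar>det A\<bar> = 1"
    and "path \<gamma>" "pathfinish \<gamma> = pathstart \<gamma>"
    and lift: "\<And>s. s \<in> {0..1} \<Longrightarrow> g s = tb_class A (\<gamma> s)"
    and in_fiber: "\<And>s. s \<in> {0..1} \<Longrightarrow> g s \<in> tb_fiber A t"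
  shows "homotopic_with (\<lambda>h. h 0 = g 0 \<and> h 1 = g 0)
           (subtopology euclideanreal {0..1}) (subtopology (tb_top A) (tb_fiber A t)) g (\<lambda>_. g 0)"
proof -
  define c where "c = snd (\<gamma> 0)"
  define H where "H = {z :: (real^2) \<times> real. snd z = c}"
  have lift_in_fiber: "tb_class A (\<gamma> s) \<in> tb_fiber A t" if "s \<in> {0..1}" for s
    using in_fiber[OF that] lift[OF that] by simp
  have \<gamma>_H: "\<gamma> s \<in> H" if "s \<in> {0..1}" for s
    using snd_path_in_tb_fiber_constant[OF unimodular \<open>path \<gamma>\<close> lift_in_fiber that]
    by (simp add: H_def c_def)
  have "homotopic_paths H \<gamma> (\<lambda>_. \<gamma> 0)"
  proof (rule homotopic_paths_linear)
    fix s :: real assume "s \<in> {0..1}"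
    then show "closed_segment (\<gamma> s) (\<gamma> 0) \<subseteq> H"
      using \<gamma>_H by (intro closed_segment_subset) (auto simp: H_def convex_horizontal_plane)
  qed (use assms(2,3) in \<open>simp_all add: path_const pathstart_def pathfinish_def\<close>)
  moreover have "continuous_map (top_of_set H) (subtopology (tb_top A) (tb_fiber A t)) (tb_class A)"
    using continuous_map_from_subtopology[OF continuous_map_tb_class[OF unimodular]]
      in_fiber[of 0] lift[of 0]
    by (auto simp: continuous_map_in_subtopology tb_class_in_fiber_iff[OF unimodular] H_def c_def)
  ultimately have "homotopic_with (\<lambda>h. h 0 = g 0 \<and> h 1 = g 0)
      (subtopology euclideanreal {0..1}) (subtopology (tb_top A) (tb_fiber A t))
      (tb_class A \<circ> \<gamma>) (tb_class A \<circ> (\<lambda>_. \<gamma> 0))"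
    unfolding homotopic_paths_def
    by (rule homotopic_with_compose_continuous_map_left)
      (use lift assms(3) in \<open>auto simp: pathstart_def pathfinish_def\<close>)
  then show ?thesis
    by (rule homotopic_with_eq) (auto simp: lift)
qed

theorem lemma7:
  fixes A :: "int^2^2" and P :: "((real^2) \<times> real) set set" and t :: real
    and g :: "real \<Rightarrow> ((real^2) \<times> real) set"
  assumes "det A = 1"
    and "tb_spine A P"
    and "pathin (subtopology (tb_top A) (tb_fiber A t)) g"
    and "g 0 = g 1"
    and "\<not> homotopic_with (\<lambda>h. h 0 = g 0 \<and> h 1 = g 0)
             (subtopology euclideanreal {0..1}) (subtopology (tb_top A) (tb_fiber A t))
             g (\<lambda>_. g 0)"
  shows "\<exists>s\<in>{0..1}. g s \<in> P \<inter> tb_fiber A t"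
proof (rule ccontr)
  assume avoids: "\<not> (\<exists>s\<in>{0..1}. g s \<in> P \<inter> tb_fiber A t)"
  have unimodular: "\<bar>det A\<bar> = 1" using assms(1) by simp
  obtain s where s: "continuous_map (subtopology (tb_top A) (tb_space A - P)) euclidean s"
    "\<And>c. c \<in> tb_space A - P \<Longrightarrow> tb_class A (s c) = c"
    using tb_spine_section[OF unimodular assms(2)] by blast
  have g: "continuous_map (top_of_set {0..1}) (subtopology (tb_top A) (tb_fiber A t)) g"
    using assms(3) by (simp add: pathin_def)
  then have in_fiber: "g r \<in> tb_fiber A t" if "r \<in> {0..1}" for r
    using that continuous_map_image_subset_topspace by fastforce
  then have in_complement: "g r \<in> tb_space A - P" if "r \<in> {0..1}" for r
    using that avoids by (auto simp: tb_fiber_def)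
  have "continuous_map (top_of_set {0..1}) (subtopology (tb_top A) (tb_space A - P)) g"
    using g in_complement by (auto simp: continuous_map_in_subtopology)
  then have "path (s \<circ> g)"
    unfolding path_def using continuous_map_compose s(1) by fastforce
  moreover have "pathfinish (s \<circ> g) = pathstart (s \<circ> g)"
    using assms(4) by (simp add: pathstart_def pathfinish_def)
  ultimately have "homotopic_with (\<lambda>h. h 0 = g 0 \<and> h 1 = g 0)
      (subtopology euclideanreal {0..1}) (subtopology (tb_top A) (tb_fiber A t)) g (\<lambda>_. g 0)"
    using s(2) in_complement in_fiber by (intro lifted_loop_in_fiber_nullhomotopic[OF unimodular]) auto
  with assms(5) show False by contradiction
qed

end
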